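(* Let $n\ge 2$ and let $\mathcal{P}$ be any regular $n$-polytope inscribed in a unit $n$-sphere. Let $V$ be the number of vertices of $\mathcal{P}$, let $N$ be the total number of chords of $\mathcal{P}$, and let $c_1,\dots,c_N$ be the lengths of these chords (one entry for each chord, so lengths are repeated according to the number of chords having that length). Then $$\sum_{i=1}^{N}c_i^2=V^2 .$$
   Context: An $n$-polytope is a finite convex polytope of full dimension $n$ in Euclidean space $\mathbb{R}^n$; its $0$-faces are its vertices, its $1$-faces its edges. An $n$-polytope is regular (the usual notion of regular convex polytope) if (1) whenever a $(j-2)$-face is incident with a $j$-face, exactly two $(j-1)$-faces are incident with both ($1\le j\le n$, counting the empty set as the unique $(-1)$-face), and (2) there is a point $\mathbf{O}$, the center, such that for each $j\in\{0,\dots,n\}$ the centers of all $j$-faces are at the same distance from $\mathbf{O}$. A unit $n$-sphere is a sphere of radius $1$ in $\mathbb{R}^n$ (so a "2-sphere" is a circle). A regular polytope is inscribed in it if all vertices lie on the sphere, whose center is the center of the polytope. A chord of a regular polytope is a line segment whose endpoints are two distinct vertices (so chords are all edges and all diagonals). *)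

theory Defs
  imports "HOL-Analysis.Analysis"
begin

(* Since "aff_dim {} = -1" and the empty set is a face of every set, the empty
   set is the unique face of dimension -1. *)
definition k_faces :: "int \<Rightarrow> 'a::euclidean_space set \<Rightarrow> 'a set set" where
  "k_faces k P = {F. F face_of P \<and> aff_dim F = k}"

definition full_polytope :: "'a::euclidean_space set \<Rightarrow> bool" where
  "full_polytope P \<longleftrightarrow> polytope P \<and> aff_dim P = int DIM('a)"

definition vertices :: "'a::euclidean_space set \<Rightarrow> 'a set" where
  "vertices P = {v. v extreme_point_of P}"

lemma k_faces_0: "k_faces 0 P = (\<lambda>v. {v}) ` vertices P"
  by (auto simp: k_faces_def vertices_def aff_dim_eq_0 face_of_singleton)

(* The center of a face is the centroid of its vertices.  For the polytope P
   itself, is_center below does not require the center z to be this point. *)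
definition face_center :: "'a::euclidean_space set \<Rightarrow> 'a" where
  "face_center F = (\<Sum>v\<in>vertices F. v) /\<^sub>R real (card (vertices F))"

definition diamond_condition :: "'a::euclidean_space set \<Rightarrow> bool" where
  "diamond_condition P \<longleftrightarrow>
     (\<forall>j\<in>{1..int DIM('a)}. \<forall>F\<in>k_faces (j - 2) P. \<forall>G\<in>k_faces j P. F \<subseteq> G \<longrightarrow>
        card {H \<in> k_faces (j - 1) P. F \<subseteq> H \<and> H \<subseteq> G} = 2)"

definition is_center :: "'a::euclidean_space set \<Rightarrow> 'a \<Rightarrow> bool" where
  "is_center P z \<longleftrightarrow>
     (\<forall>j\<in>{0..int DIM('a)}. \<forall>F\<in>k_faces j P. \<forall>G\<in>k_faces j P.
        dist z (face_center F) = dist z (face_center G))"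

definition regular_polytope :: "'a::euclidean_space set \<Rightarrow> bool" where
  "regular_polytope P \<longleftrightarrow>
     full_polytope P \<and> diamond_condition P \<and> (\<exists>z. is_center P z)"

definition inscribed_in_sphere :: "'a::euclidean_space set \<Rightarrow> 'a \<Rightarrow> real \<Rightarrow> bool" where
  "inscribed_in_sphere P z r \<longleftrightarrow> is_center P z \<and> vertices P \<subseteq> sphere z r"

(* Chords are segments as point sets, so the chord joining v and w is the same
   as the chord joining w and v and is counted once. *)
definition chords :: "'a::euclidean_space set \<Rightarrow> 'a set set" where
  "chords P = {closed_segment v w | v w. v \<in> vertices P \<and> w \<in> vertices P \<and> v \<noteq> w}"

(* The length of a chord is its diameter as a point set. *)
lemma diameter_segment:
  fixes v w :: "'a::euclidean_space"
  shows "diameter (closed_segment v w) = dist v w"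
proof (rule antisym)
  have "norm (x - y) \<le> dist v w" if xy: "x \<in> closed_segment v w" "y \<in> closed_segment v w" for x y
  proof -
    obtain s t where s: "x = (1 - s) *\<^sub>R v + s *\<^sub>R w" "0 \<le> s" "s \<le> 1"
      and t: "y = (1 - t) *\<^sub>R v + t *\<^sub>R w" "0 \<le> t" "t \<le> 1"
      using xy unfolding closed_segment_def by blast
    have "x - y = (t - s) *\<^sub>R (v - w)"
      unfolding s t by (simp add: algebra_simps)
    then have "norm (x - y) = \<bar>t - s\<bar> * dist v w"
      by (simp add: dist_norm)
    also have "\<dots> \<le> 1 * dist v w"
      using s t by (intro mult_right_mono) auto
    finally show ?thesis by simp
  qed
  then show "diameter (closed_segment v w) \<le> dist v w"
    by (intro diameter_le) auto
  show "dist v w \<le> diameter (closed_segment v w)"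
    by (rule diameter_bounded_bound) (auto simp: bounded_closed_segment)
qed

end

theory Submission
  imports Defs
begin

text \<open>
  Let \<open>V\<close> be the set of vertices. When \<open>V\<close> lies on the unit sphere around \<open>z\<close>, expanding the squared
  distances gives \<open>card V ^ 2 - norm (\<Sum>v\<in>V. v - z) ^ 2\<close> for the sum over the chords
  (\<open>sum_dist_squared_balanced\<close>, with the ordered pairs counted in \<open>sum_chords\<close>). So all that has to
  be shown is that the centroid of the vertices is the center \<open>z\<close>.

  This is a symmetry argument, carried out in every face \<open>G\<close> by induction on its dimension \<open>k\<close>: the
  centroid of \<open>G\<close> is the foot \<open>q\<close> of the perpendicular from \<open>z\<close> to the affine hull of \<open>G\<close>
  (\<open>face_center_perpendicular\<close>). By the induction hypothesis, applied to the proper faces of \<open>G\<close>, the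
  centers \<open>c 0, ..., c (k - 1)\<close> of the faces in a flag of \<open>G\<close>, seen from \<open>q\<close>, form an orthoscheme: the
  inner product of \<open>c i\<close> and \<open>c j\<close> is the squared norm of the one with the larger index. As the
  distances from \<open>z\<close> depend on the dimension only, all these orthoschemes are congruent. By the
  diamond condition each has a neighbour across each of its walls, and congruence forces the
  neighbour to be the mirror image in that wall. The geometry of \<open>G\<close> enters the remaining argument
  through supporting hyperplanes only, so it is done for abstract systems of orthoschemes:

  \<^item> The reflections in the walls of one orthoscheme permute the orthoschemes that can be reached from
    it by crossing walls. The sum of the vertices \<open>c 0\<close> reached is then fixed by the reflections, and
    as only the zero vector lies on all walls, it vanishes (\<open>component_vertices_sum_zero\<close>).

  \<^item> Every vertex of \<open>G\<close> is reached: the cones over the orthoschemes reached already cover the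
    whole space (\<open>cones_cover\<close>), and a vertex in
    the cone of an orthoscheme is the vertex \<open>c 0\<close> of that orthoscheme, because it is not beyond the
    facet and as far from \<open>q\<close> as \<open>c 0\<close> (\<open>vertex_in_orthoscheme\<close>).
\<close>

section \<open>Systems of orthoschemes\<close>

text \<open>
  An element \<open>c\<close> of \<open>C\<close> lists the vertices \<open>c 0, ..., c (k - 1)\<close> of a \<open>k\<close>-dimensional orthoscheme whose
  remaining vertex is the origin. The entries from \<open>k\<close> on repeat the origin, so that the Gram matrix
  has one formula for all indices and \<open>C\<close> can be finite as a set of functions. All orthoschemes
  in \<open>C\<close> share the Gram matrix given by \<open>g\<close>, that is, they are congruent.
\<close>

locale orthoscheme_system =
  fixes L :: "'a::euclidean_space set" and k :: nat and g :: "nat \<Rightarrow> real"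
    and C :: "(nat \<Rightarrow> 'a) set"
  assumes subspace_L: "subspace L" and dim_L: "dim L = k"
    and mem_L: "c \<in> C \<Longrightarrow> c i \<in> L"
    and zero_beyond: "c \<in> C \<Longrightarrow> k \<le> i \<Longrightarrow> c i = 0"
    and gram_le: "c \<in> C \<Longrightarrow> i \<le> j \<Longrightarrow> c i \<bullet> c j = g j"
    and decr: "i < k \<Longrightarrow> g (Suc i) < g i"
    and exists_adjacent: "c \<in> C \<Longrightarrow> i < k \<Longrightarrow> \<exists>x. x \<noteq> c i \<and> c(i := x) \<in> C"
    and finite_C: "finite C" and nonempty: "C \<noteq> {}"
begin

lemma gram: "c \<in> C \<Longrightarrow> c i \<bullet> c j = g (max i j)"
  using gram_le[of c i j] gram_le[of c j i] by (cases "i \<le> j") (auto simp: max_def inner_commute)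

lemma g_beyond: "k \<le> i \<Longrightarrow> g i = 0"
  using nonempty gram_le[of _ i i] zero_beyond by fastforce

lemma g_antimono: "i \<le> j \<Longrightarrow> g j \<le> g i"
proof (rule lift_Suc_antimono_le[of g])
  fix n show "g (Suc n) \<le> g n"
    using decr[of n] g_beyond[of n] g_beyond[of "Suc n"] by (cases "n < k") auto
qed

lemma g_pos: "i < k \<Longrightarrow> 0 < g i"
  using decr[of i] g_antimono[of "Suc i" k] g_beyond[of k] by simp

lemma g_nonneg: "0 \<le> g i"
  using g_pos[of i] g_beyond[of i] by (cases "i < k") auto

text \<open>The successive differences of an orthoscheme are pairwise orthogonal and nonzero, so its
  \<open>k\<close> vertices other than the origin form a basis of \<open>L\<close>.\<close>

lemma L_subset_span:
  assumes c: "c \<in> C"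
  shows "L \<subseteq> span (c ` {..<k})"
proof -
  define e where "e i = c i - c (Suc i)" for i
  have orth: "e i \<bullet> e j = 0" if "i < j" for i j
    using that by (simp add: e_def inner_diff gram[OF c] max_def)
  have sq: "e i \<bullet> e i > 0" if "i < k" for i
    using decr[OF that] by (simp add: e_def inner_diff gram[OF c] max_def)
  have orth': "e i \<bullet> e j = 0" if "i \<noteq> j" for i j
    using that orth[of i j] orth[of j i] by (cases "i < j") (auto simp: inner_commute)
  have inj: "inj_on e {..<k}"
    by (rule inj_onI) (metis orth' sq lessThan_iff less_irrefl)
  have "pairwise orthogonal (e ` {..<k})"
    by (auto simp: pairwise_def orthogonal_def) (metis orth')
  moreover have "0 \<notin> e ` {..<k}"
    using sq by (metis imageE inner_zero_left lessThan_iff less_irrefl)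
  ultimately have "independent (e ` {..<k})"
    by (rule pairwise_orthogonal_independent)
  moreover have "e ` {..<k} \<subseteq> L"
    using mem_L[OF c] by (auto simp: e_def intro!: subspace_diff subspace_L)
  moreover have "dim L \<le> card (e ` {..<k})"
    by (simp add: card_image[OF inj] dim_L)
  ultimately have "L \<subseteq> span (e ` {..<k})"
    by (intro card_ge_dim_independent)
  also have "\<dots> \<subseteq> span (c ` {..<k})"
  proof (rule span_minimal)
    have "c i \<in> span (c ` {..<k})" for i
      using zero_beyond[OF c, of i] by (cases "i < k") (auto intro: span_base span_zero)
    then show "e ` {..<k} \<subseteq> span (c ` {..<k})"
      by (auto simp: e_def intro: span_diff)
  qed simp
  finally show ?thesis .
qed

lemma expansion:
  assumes c: "c \<in> C" and y: "y \<in> L"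
  obtains l where "y = (\<Sum>i<k. l i *\<^sub>R c i)"
proof -
  have inj: "inj_on c {..<k}"
  proof (rule linorder_inj_onI)
    fix i j assume ij: "i < j" "i \<in> {..<k}"
    have "c i \<bullet> c i \<noteq> c j \<bullet> c j"
      using ij decr[of i] g_antimono[of "Suc i" j] by (simp add: gram[OF c])
    then show "c i \<noteq> c j" by metis
  qed auto
  obtain u where "y = (\<Sum>v\<in>c ` {..<k}. u v *\<^sub>R v)"
    using L_subset_span[OF c] y by (auto simp: span_finite)
  then show thesis
    by (intro that[of "u \<circ> c"]) (simp add: sum.reindex[OF inj])
qed

lemma ortho_zero:
  assumes c: "c \<in> C" and u: "u \<in> L" "\<And>i. i < k \<Longrightarrow> u \<bullet> c i = 0"
  shows "u = 0"
proof -
  obtain l where l: "u = (\<Sum>i<k. l i *\<^sub>R c i)"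
    using expansion[OF c u(1)] .
  have "u \<bullet> u = (\<Sum>i<k. l i * (u \<bullet> c i))"
    by (subst (2) l) (simp add: inner_sum_right)
  then show ?thesis
    using u(2) by simp
qed

lemma adjacent_ortho:
  assumes c: "c \<in> C" and x: "c(i := x) \<in> C" and j: "j \<noteq> i"
  shows "c j \<bullet> (c i - x) = 0"
  using gram[OF x, of j i] gram[OF c, of j i] j by (simp add: inner_diff_right)

lemma adjacent_norm:
  assumes "c \<in> C" "c(i := x) \<in> C"
  shows "x \<bullet> x = c i \<bullet> c i"
  using gram[OF assms(1), of i i] gram[OF assms(2), of i i] by simp

text \<open>The vector joining the two apices over a common wall is normal to that wall, so pairing it with
  a vector reads off one coordinate of the vector, up to a positive factor.\<close>

lemma adjacent_coordinate:
  assumes c: "c \<in> C" and x: "c(i := x) \<in> C" "x \<noteq> c i" and i: "i < k"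
  obtains a where "0 < a" "\<And>l. (\<Sum>j<k. l j *\<^sub>R c j) \<bullet> (c i - x) = l i * a"
proof (rule that)
  have "2 * (c i \<bullet> (c i - x)) = (c i - x) \<bullet> (c i - x)"
    using adjacent_norm[OF c x(1)] by (simp add: inner_diff algebra_simps inner_commute)
  moreover have "(c i - x) \<bullet> (c i - x) > 0"
    using x(2) by simp
  ultimately show "0 < c i \<bullet> (c i - x)"
    by linarith
  fix l
  have "(\<Sum>j<k. l j *\<^sub>R c j) \<bullet> (c i - x) = (\<Sum>j<k. l j * (c j \<bullet> (c i - x)))"
    by (simp add: inner_sum_left)
  also have "\<dots> = (\<Sum>j<k. if j = i then l i * (c i \<bullet> (c i - x)) else 0)"
    by (intro sum.cong) (auto simp: adjacent_ortho[OF c x(1)])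
  finally show "(\<Sum>j<k. l j *\<^sub>R c j) \<bullet> (c i - x) = l i * (c i \<bullet> (c i - x))"
    using i by simp
qed

text \<open>The cones over the orthoschemes cover \<open>L\<close>: choose the orthoscheme whose barycenter lies
  furthest in the direction \<open>y\<close>. Crossing a wall does not increase this quantity, which says that
  \<open>y\<close> is on the inner side of each wall.\<close>

lemma cones_cover:
  assumes y: "y \<in> L"
  obtains c l where "c \<in> C" "\<And>i. i < k \<Longrightarrow> 0 \<le> l i" "y = (\<Sum>i<k. l i *\<^sub>R c i)"
proof -
  define h where "h c = y \<bullet> (\<Sum>i<k. c i)" for c
  obtain c where c: "c \<in> C" and mx: "\<And>d. d \<in> C \<Longrightarrow> h d \<le> h c"
  proof -
    have "Max (h ` C) \<in> h ` C"
      using finite_C nonempty by (intro Max_in) auto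
    then obtain c where "c \<in> C" "h c = Max (h ` C)"
      by auto
    then show thesis
      using that[of c] finite_C by auto
  qed
  obtain l where l: "y = (\<Sum>i<k. l i *\<^sub>R c i)"
    using expansion[OF c y] .
  have "0 \<le> l i" if i: "i < k" for i
  proof -
    obtain x where x: "x \<noteq> c i" "c(i := x) \<in> C"
      using exists_adjacent[OF c i] by auto
    obtain a where a: "0 < a" "\<And>l. (\<Sum>j<k. l j *\<^sub>R c j) \<bullet> (c i - x) = l i * a"
      using adjacent_coordinate[OF c x(2,1) i] by blast
    have "(\<Sum>j<k. c j) - (\<Sum>j<k. (c(i := x)) j) = (\<Sum>j<k. if j = i then c i - x else 0)"
      by (subst sum_subtractf[symmetric], intro sum.cong) auto
    also have "\<dots> = c i - x"
      using i by simp
    finally have "h c - h (c(i := x)) = y \<bullet> (c i - x)"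
      by (simp only: h_def inner_diff_right[symmetric])
    then have "0 \<le> l i * a"
      using mx[OF x(2)] a(2)[of l] l by simp
    then show ?thesis
      using a(1) by (simp add: zero_le_mult_iff)
  qed
  then show thesis
    using that c l by blast
qed

inductive_set component :: "(nat \<Rightarrow> 'a) \<Rightarrow> (nat \<Rightarrow> 'a) set" for c0 where
  base: "c0 \<in> component c0"
| step: "c \<in> component c0 \<Longrightarrow> i < k \<Longrightarrow> x \<noteq> c i \<Longrightarrow> c(i := x) \<in> C \<Longrightarrow> c(i := x) \<in> component c0"

lemma component_subset: "c0 \<in> C \<Longrightarrow> component c0 \<subseteq> C"
  by (auto elim: component.induct)

lemma component_system:
  assumes c0: "c0 \<in> C"
  shows "orthoscheme_system L k g (component c0)"
proof
  fix c i assume "c \<in> component c0" "i < k"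
  then show "\<exists>x. x \<noteq> c i \<and> c(i := x) \<in> component c0"
    using exists_adjacent[of c i] component_subset[OF c0] by (meson component.step subset_iff)
qed (use component_subset[OF c0] in \<open>auto intro: subspace_L dim_L mem_L zero_beyond gram_le decr
        finite_subset[OF _ finite_C] component.base\<close>)

text \<open>An orthoscheme has only one neighbour across a given wall: the candidates for the new vertex
  lie on a line normal to the wall, which meets the sphere through the old vertex in one further
  point.\<close>

lemma adjacent_unique:
  assumes c: "c \<in> C" and m: "m < k"
    and x: "x \<in> L" "x \<noteq> c m" "x \<bullet> x = g m" "\<And>j. j < k \<Longrightarrow> j \<noteq> m \<Longrightarrow> x \<bullet> c j = g (max m j)"
    and y: "c(m := y) \<in> C" "y \<noteq> c m"
  shows "x = y"
proof -
  have yL: "y \<in> L"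
    using mem_L[OF y(1), of m] by simp
  define w where "w = c m - y"
  define t where "t = ((c m - x) \<bullet> c m) / (w \<bullet> c m)"
  have norms: "c m \<bullet> c m = g m" "y \<bullet> y = g m"
    using gram[OF c, of m m] gram[OF y(1), of m m] by simp_all
  have "w \<bullet> w = 2 * (w \<bullet> c m)"
    using norms by (simp add: w_def inner_diff algebra_simps inner_commute)
  moreover have "w \<bullet> w > 0"
    using y(2) by (simp add: w_def)
  ultimately have wc: "w \<bullet> w = 2 * (w \<bullet> c m)" "w \<bullet> c m > 0"
    by linarith+
  \<comment> \<open>\<open>t\<close> is chosen so that the combination below is orthogonal to \<open>c m\<close>, too.\<close>
  have "(c m - x) - t *\<^sub>R w = 0"
  proof (rule ortho_zero[OF c])
    show "(c m - x) - t *\<^sub>R w \<in> L"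
      unfolding w_def by (intro subspace_diff subspace_scale subspace_L mem_L[OF c] x(1) yL)
    fix j assume j: "j < k"
    show "((c m - x) - t *\<^sub>R w) \<bullet> c j = 0"
    proof (cases "j = m")
      case True
      then show ?thesis
        using wc(2) by (simp add: t_def inner_diff_left)
    next
      case False
      then show ?thesis
        using x(4)[OF j False] adjacent_ortho[OF c y(1) False] gram[OF c, of m j]
        by (simp add: w_def inner_diff_left inner_diff_right inner_commute)
    qed
  qed
  then have cx: "c m - x = t *\<^sub>R w"
    by simp
  have "2 * ((c m - x) \<bullet> c m) = (c m - x) \<bullet> (c m - x)"
    using norms x(3) by (simp add: inner_diff algebra_simps inner_commute)
  then have "t = 0 \<or> t = 1"
    unfolding cx using wc by auto
  then have "t = 1"
    using cx x(2) by auto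
  then show ?thesis
    using cx by (simp add: w_def)
qed

text \<open>Hence adjacency is determined by the metric, and an isometry that keeps one orthoscheme in
  its component keeps them all in it.\<close>

lemma isometry_preserves_component:
  assumes c0: "c0 \<in> C" and T: "linear T" "\<And>x y. T x \<bullet> T y = x \<bullet> y" "\<And>x. x \<in> L \<Longrightarrow> T x \<in> L"
    and Tc0: "T \<circ> c0 \<in> component c0" and c: "c \<in> component c0"
  shows "T \<circ> c \<in> component c0"
  using c
proof induction
  case base
  show ?case by (rule Tc0)
next
  case (step c m x)
  have cC: "c \<in> C" and TcC: "T \<circ> c \<in> C"
    using step.hyps(1) step.IH component_subset[OF c0] by blast+
  obtain x' where x': "x' \<noteq> T (c m)" "(T \<circ> c)(m := x') \<in> C"
    using exists_adjacent[OF TcC step.hyps(2)] by auto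
  have "T x = x'"
  proof (rule adjacent_unique[OF TcC step.hyps(2)])
    show "T x \<in> L"
      using mem_L[OF step.hyps(4), of m] T(3) by simp
    have "T x - T (c m) = T (x - c m)"
      using T(1) by (simp add: linear_diff)
    moreover have "T (x - c m) \<bullet> T (x - c m) \<noteq> 0"
      using step.hyps(3) T(2) by simp
    ultimately show "T x \<noteq> (T \<circ> c) m"
      by auto
    show "T x \<bullet> T x = g m"
      using gram[OF step.hyps(4), of m m] T(2) by simp
    show "T x \<bullet> (T \<circ> c) j = g (max m j)" if "j < k" "j \<noteq> m" for j
      using gram[OF step.hyps(4), of m j] that T(2) by simp
  qed (use x' in auto)
  then have "T \<circ> c(m := x) = (T \<circ> c)(m := x')"
    by auto
  moreover have "(T \<circ> c)(m := x') \<in> component c0"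
    by (rule component.step[OF step.IH step.hyps(2)])
      (use x' in \<open>simp_all del: fun_upd_apply add: comp_def\<close>)
  ultimately show ?case
    by (simp only:)
qed

text \<open>The sum of the vertices is fixed by the reflection in each wall of \<open>c0\<close>, hence lies on each
  wall; the walls have only the origin in common.\<close>

lemma component_vertices_sum_zero:
  assumes c0: "c0 \<in> C"
  shows "(\<Sum>v\<in>(\<lambda>c. c 0) ` component c0. v) = 0"
proof -
  define X where "X = (\<lambda>c. c 0) ` component c0"
  define S where "S = \<Sum>X"
  have XL: "X \<subseteq> L"
    using component_subset[OF c0] mem_L by (auto simp: X_def)
  have finX: "finite X"
    unfolding X_def using component_subset[OF c0] finite_C finite_subset by blast
  have "S \<in> L"
    unfolding S_def using XL by (intro subspace_sum subspace_L) auto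
  then obtain l where l: "S = (\<Sum>i<k. l i *\<^sub>R c0 i)"
    using expansion[OF c0] by blast
  have "l i = 0" if i: "i < k" for i
  proof -
    obtain x where x: "x \<noteq> c0 i" "c0(i := x) \<in> C"
      using exists_adjacent[OF c0 i] by auto
    define w where "w = c0 i - x"
    have ww: "w \<bullet> w > 0"
      using x(1) by (simp add: w_def)
    \<comment> \<open>the reflection in the wall opposite to vertex \<open>i\<close>\<close>
    define T where "T y = y - (2 * (y \<bullet> w) / (w \<bullet> w)) *\<^sub>R w" for y
    have lin: "linear T"
      by (rule linearI) (simp_all add: T_def inner_add_left add_divide_distrib algebra_simps)
    have iso: "T a \<bullet> T b = a \<bullet> b" for a b
      using ww by (simp add: T_def inner_diff inner_commute field_simps)
    have inj: "inj T"
      using iso by (metis (no_types, lifting) inner_eq_zero_iff lin linear_injective_0)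
    have wL: "w \<in> L"
      using mem_L[OF x(2), of i] mem_L[OF c0] by (simp add: w_def subspace_diff subspace_L)
    have TL: "T y \<in> L" if "y \<in> L" for y
      unfolding T_def by (intro subspace_diff subspace_scale subspace_L wL that)
    have "2 * (c0 i \<bullet> w) = w \<bullet> w"
      using adjacent_norm[OF c0 x(2)] by (simp add: w_def inner_diff algebra_simps inner_commute)
    then have "T (c0 i) = x"
      using ww by (simp add: T_def) (simp add: w_def)
    moreover have "T (c0 j) = c0 j" if "j \<noteq> i" for j
      using adjacent_ortho[OF c0 x(2) that] by (simp add: T_def w_def)
    ultimately have "T \<circ> c0 = c0(i := x)"
      by auto
    then have Tc0: "T \<circ> c0 \<in> component c0"
      using component.step[OF component.base i] x by simp
    have "T ` X \<subseteq> X"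
    proof
      fix v assume "v \<in> T ` X"
      then obtain c where "c \<in> component c0" "v = (T \<circ> c) 0"
        by (auto simp: X_def)
      then show "v \<in> X"
        unfolding X_def using isometry_preserves_component[OF c0 lin iso TL Tc0] by blast
    qed
    then have "T ` X = X"
      using finX inj by (metis endo_inj_surj inj_on_subset subset_UNIV)
    then have "S = (\<Sum>v\<in>T ` X. v)"
      by (simp add: S_def)
    also have "\<dots> = T S"
      using inj by (simp add: S_def linear_sum[OF lin] sum.reindex inj_on_subset)
    finally have "S \<bullet> w = 0"
      using ww by (auto simp: T_def)
    then show "l i = 0"
      using adjacent_coordinate[OF c0 x(2,1) i] l unfolding w_def
      by (metis less_irrefl mult_eq_0_iff)
  qed
  then have "S = 0"
    using l by simp
  then show ?thesis
    by (simp add: S_def X_def)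
qed

text \<open>The functional \<open>a\<close> supports \<open>Q\<close> along the facet of \<open>c\<close>. On \<open>L\<close> it is a multiple of the inner product
  with the center \<open>c (k - 1)\<close> of that facet; the point is that the multiple is positive, i.e. that
  \<open>Q\<close> lies on the same side of the facet as the origin. Otherwise all points of \<open>Q\<close>, so all vertices
  of orthoschemes, would have a positive inner product with \<open>c (k - 1)\<close>, and no cone could contain
  \<open>- c (k - 1)\<close>.\<close>

lemma facet_bound:
  assumes Q: "Q \<subseteq> L" and k: "0 < k"
    and CQ: "\<And>c i. c \<in> C \<Longrightarrow> i < k \<Longrightarrow> c i \<in> Q"
    and c: "c \<in> C" and a: "\<And>y. y \<in> Q \<Longrightarrow> a \<bullet> y \<le> b" "\<And>i. i < k \<Longrightarrow> a \<bullet> c i = b"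
      "y0 \<in> Q" "a \<bullet> y0 \<noteq> b"
    and v: "v \<in> Q"
  shows "v \<bullet> c (k - 1) \<le> g (k - 1)"
proof -
  define n where "n = c (k - 1)"
  have gp: "0 < g (k - 1)"
    using g_pos[of "k - 1"] k by simp
  have cn: "c i \<bullet> n = g (k - 1)" if "i < k" for i
    unfolding n_def using that by (intro gram_le[OF c]) simp
  have propor: "a \<bullet> y * g (k - 1) = b * (y \<bullet> n)" if y: "y \<in> L" for y
  proof -
    obtain l where "y = (\<Sum>i<k. l i *\<^sub>R c i)"
      using expansion[OF c y] .
    then show ?thesis
      using a(2) cn by (simp add: inner_sum_left inner_sum_right sum_distrib_left[symmetric]
          sum_distrib_right[symmetric] ac_simps)
  qed
  have le: "b * (y \<bullet> n) \<le> b * g (k - 1)" if y: "y \<in> Q" for y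
  proof -
    have "a \<bullet> y * g (k - 1) \<le> b * g (k - 1)"
      using a(1)[OF y] gp by (intro mult_right_mono) auto
    then show ?thesis
      using propor[of y] y Q by auto
  qed
  have "b > 0"
  proof (rule ccontr)
    assume "\<not> b > 0"
    moreover have "b \<noteq> 0"
      using propor[of y0] a(3,4) Q gp by auto
    ultimately have b: "b < 0" by simp
    have pos: "y \<bullet> n > 0" if y: "y \<in> Q" for y
      using le[OF y] b gp by (simp add: mult_le_cancel_left)
    have "- n \<in> L"
      using mem_L[OF c] by (simp add: n_def subspace_neg subspace_L)
    then obtain d l where d: "d \<in> C" "\<And>i. i < k \<Longrightarrow> 0 \<le> l i" "- n = (\<Sum>i<k. l i *\<^sub>R d i)"
      using cones_cover by blast
    have "- (n \<bullet> n) = (\<Sum>i<k. l i * (d i \<bullet> n))"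
      by (metis (no_types, lifting) d(3) inner_minus_left inner_scaleR_left inner_sum_left sum.cong)
    also have "\<dots> \<ge> 0"
      using d(2) pos[OF CQ[OF d(1)]]
      by (intro sum_nonneg mult_nonneg_nonneg) (auto intro: less_imp_le)
    finally show False
      using cn[of "k - 1"] k gp by (simp add: n_def)
  qed
  then show ?thesis
    using le[OF v] by (simp add: n_def)
qed

text \<open>Write \<open>v\<close> with nonnegative coefficients in the orthoscheme whose cone contains it. Since \<open>v\<close> is not
  beyond the facet, the coefficients add up to at most \<open>1\<close>. As \<open>c 0\<close> is the vertex farthest from
  the origin, a point of the simplex that is as far as \<open>c 0\<close> must be \<open>c 0\<close>; in the computation,
  \<open>v \<bullet> c 0\<close> is at least the common squared norm of \<open>v\<close> and \<open>c 0\<close>.\<close>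

lemma vertex_in_orthoscheme:
  assumes v: "v \<in> L" "v \<bullet> v = g 0" and k: "0 < k"
    and bound: "\<And>c. c \<in> C \<Longrightarrow> v \<bullet> c (k - 1) \<le> g (k - 1)"
  obtains c where "c \<in> C" "v = c 0"
proof -
  obtain c l where c: "c \<in> C" and l: "\<And>i. i < k \<Longrightarrow> 0 \<le> l i" "v = (\<Sum>i<k. l i *\<^sub>R c i)"
    using cones_cover[OF v(1)] by blast
  have inner_v: "v \<bullet> y = (\<Sum>i<k. l i * (c i \<bullet> y))" for y
    by (simp add: l(2) inner_sum_left)
  have gp: "0 < g (k - 1)"
    using g_pos[of "k - 1"] k by simp
  have "(\<Sum>i<k. l i) * g (k - 1) = v \<bullet> c (k - 1)"
    by (auto simp: inner_v sum_distrib_right gram_le[OF c] intro!: sum.cong)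
  also have "\<dots> \<le> 1 * g (k - 1)"
    using bound[OF c] by simp
  finally have sum_le: "(\<Sum>i<k. l i) \<le> 1"
    using gp by (simp add: mult_le_cancel_right)
  have le: "v \<bullet> c i \<le> g i" for i
  proof -
    have "v \<bullet> c i = (\<Sum>j<k. l j * g (max j i))"
      by (simp add: inner_v gram[OF c])
    also have "\<dots> \<le> (\<Sum>j<k. l j * g i)"
      using l(1) by (intro sum_mono mult_left_mono g_antimono) auto
    also have "\<dots> \<le> 1 * g i"
      unfolding sum_distrib_right[symmetric] by (intro mult_right_mono sum_le g_nonneg)
    finally show ?thesis by simp
  qed
  have "g 0 = (\<Sum>i<k. l i * (v \<bullet> c i))"
    using inner_v[of v] v(2) by (simp add: inner_commute)
  also have "\<dots> \<le> (\<Sum>i<k. l i * g i)"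
    using l(1) le by (intro sum_mono mult_left_mono) auto
  also have "\<dots> = v \<bullet> c 0"
    by (simp add: inner_v gram[OF c])
  finally have "(v - c 0) \<bullet> (v - c 0) \<le> 0"
    using v(2) gram[OF c, of 0 0] by (simp add: inner_diff inner_commute)
  then have "v = c 0"
    by (metis eq_iff_diff_eq_0 inner_eq_zero_iff inner_ge_zero order_antisym)
  then show thesis
    using that c by blast
qed

text \<open>Here \<open>Q\<close> stands for a polytope with vertex set \<open>V\<close>, the orthoschemes come from its flags, and
  the last assumption gives a supporting hyperplane for the facet in a flag. A component is a system
  of orthoschemes itself, so its cones already cover \<open>L\<close> and it accounts for all of \<open>V\<close>.\<close>

lemma vertices_sum_zero:
  assumes k: "0 < k" and Q: "Q \<subseteq> L" and V: "V \<subseteq> Q" "\<And>v. v \<in> V \<Longrightarrow> v \<bullet> v = g 0"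
    and CQ: "\<And>c i. c \<in> C \<Longrightarrow> i < k \<Longrightarrow> c i \<in> Q" and CV: "\<And>c. c \<in> C \<Longrightarrow> c 0 \<in> V"
    and facet: "\<And>c. c \<in> C \<Longrightarrow>
      \<exists>a b. (\<forall>y\<in>Q. a \<bullet> y \<le> b) \<and> (\<forall>i<k. a \<bullet> c i = b) \<and> (\<exists>y\<in>Q. a \<bullet> y \<noteq> b)"
  shows "\<Sum>V = 0"
proof -
  obtain c0 where c0: "c0 \<in> C"
    using nonempty by blast
  interpret K: orthoscheme_system L k g "component c0"
    by (rule component_system[OF c0])
  have bound: "v \<bullet> c (k - 1) \<le> g (k - 1)" if vc: "v \<in> V" "c \<in> C" for v c
  proof -
    obtain a b y where "\<forall>y\<in>Q. a \<bullet> y \<le> b" "\<forall>i<k. a \<bullet> c i = b" "y \<in> Q" "a \<bullet> y \<noteq> b"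
      using facet[OF vc(2)] by blast
    then show ?thesis
      using facet_bound[OF Q k, of c a b y v] CQ vc V(1) by blast
  qed
  have "V = (\<lambda>c. c 0) ` component c0"
  proof
    show "V \<subseteq> (\<lambda>c. c 0) ` component c0"
    proof
      fix v assume v: "v \<in> V"
      obtain c where "c \<in> component c0" "v = c 0"
        using K.vertex_in_orthoscheme[of v] bound[OF v] component_subset[OF c0] v V Q k
        by (metis subset_iff)
      then show "v \<in> (\<lambda>c. c 0) ` component c0" by blast
    qed
  qed (use CV component_subset[OF c0] in auto)
  then show ?thesis
    using component_vertices_sum_zero[OF c0] by simp
qed

end

section \<open>Centroids of faces\<close>

lemma polytope_k_face: "polytope P \<Longrightarrow> F \<in> k_faces j P \<Longrightarrow> polytope F"
  by (auto simp: k_faces_def intro: face_of_polytope_polytope)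

lemma k_face_nonempty: "F \<in> k_faces j P \<Longrightarrow> 0 \<le> j \<Longrightarrow> F \<noteq> {}"
  by (auto simp: k_faces_def)

lemma finite_vertices: "polytope F \<Longrightarrow> finite (vertices F)"
  unfolding vertices_def by (intro finite_polyhedron_extreme_points polytope_imp_polyhedron)

lemma convex_hull_vertices: "polytope F \<Longrightarrow> convex hull vertices F = F"
  unfolding vertices_def
  using Krein_Milman_Minkowski[of F] by (simp add: polytope_imp_compact polytope_imp_convex)

lemma vertices_nonempty: "polytope F \<Longrightarrow> F \<noteq> {} \<Longrightarrow> vertices F \<noteq> {}"
  using convex_hull_vertices by fastforce

lemma vertices_subset: "vertices F \<subseteq> F"
  by (auto simp: vertices_def extreme_point_of_def)

lemma face_center_singleton: "face_center {v} = v"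
proof -
  have "vertices {v} = {v}"
    by (auto simp: vertices_def extreme_point_of_def)
  then show ?thesis
    by (simp add: face_center_def)
qed

lemma sum_vertices_diff:
  assumes F: "polytope F" "F \<noteq> {}"
  shows "(\<Sum>v\<in>vertices F. v - q) = real (card (vertices F)) *\<^sub>R (face_center F - q)"
    and "0 < card (vertices F)"
proof -
  show "0 < card (vertices F)"
    using finite_vertices[OF F(1)] vertices_nonempty[OF F] by (simp add: card_gt_0_iff)
  then show "(\<Sum>v\<in>vertices F. v - q) = real (card (vertices F)) *\<^sub>R (face_center F - q)"
    by (simp add: face_center_def sum_subtractf sum_constant_scaleR scaleR_diff_right
        del: sum_constant)
qed

lemma face_center_mem:
  assumes F: "polytope F" "F \<noteq> {}"
  shows "face_center F \<in> F"
proof -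
  have "(\<Sum>v\<in>vertices F. (1 / real (card (vertices F))) *\<^sub>R v) \<in> F"
    using F vertices_subset finite_vertices[OF F(1)] vertices_nonempty[OF F]
    by (intro convex_sum polytope_imp_convex) auto
  then show ?thesis
    by (simp add: face_center_def scaleR_sum_right inverse_eq_divide)
qed

text \<open>A face of a polytope is the set where some linear functional attains its maximum; if the functional is
  maximal at the centroid of a set of points, it is maximal at each of them.\<close>

lemma face_center_in_face:
  assumes P: "polytope P" and F: "F face_of P" and G: "polytope G" "G \<noteq> {}" "G \<subseteq> P"
    and mem: "face_center G \<in> F"
  shows "G \<subseteq> F"
proof -
  have "F exposed_face_of P"
    using P F by (simp add: exposed_face_of_polyhedron polytope_imp_polyhedron)
  then obtain a b where ab: "P \<subseteq> {x. a \<bullet> x \<le> b}" "F = P \<inter> {x. a \<bullet> x = b}"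
    by (auto simp: exposed_face_of_def)
  define n where "n = real (card (vertices G))"
  have n: "n > 0"
    using sum_vertices_diff(2)[OF G(1,2)] by (simp add: n_def)
  have "a \<bullet> face_center G = b"
    using mem ab by auto
  then have "(\<Sum>v\<in>vertices G. a \<bullet> v) = n * b"
    using n by (simp add: face_center_def inner_sum_right n_def[symmetric] field_simps)
  then have "(\<Sum>v\<in>vertices G. b - a \<bullet> v) = 0"
    by (simp add: sum_subtractf n_def)
  then have "\<forall>v\<in>vertices G. b - a \<bullet> v = 0"
    using ab(1) G(3) vertices_subset finite_vertices[OF G(1)]
    by (subst (asm) sum_nonneg_eq_0_iff) fastforce+
  then have "vertices G \<subseteq> F"
    using ab(2) G(3) vertices_subset by fastforce
  then have "convex hull vertices G \<subseteq> F"
    using F face_of_imp_convex hull_minimal by metis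
  then show ?thesis
    using convex_hull_vertices[OF G(1)] by simp
qed

text \<open>The centroid of a face lies on no smaller face, so it determines the face.\<close>

lemma face_center_neq:
  assumes P: "polytope P" and F: "F \<in> k_faces i P" and G: "G \<in> k_faces j P"
    and ij: "0 \<le> i" "i \<le> j" "F \<noteq> G"
  shows "face_center F \<noteq> face_center G"
proof
  assume "face_center F = face_center G"
  moreover have "face_center F \<in> F"
    using face_center_mem polytope_k_face[OF P F] k_face_nonempty[OF F ij(1)] by blast
  ultimately have "G \<subseteq> F"
    using face_center_in_face[OF P _ polytope_k_face[OF P G] k_face_nonempty[OF G]] F G ij
    by (auto simp: k_faces_def face_of_imp_subset)
  then have "G face_of F"
    using F G face_of_face by (auto simp: k_faces_def)
  then have "aff_dim G < aff_dim F"
    using face_of_aff_dim_lt[of F G] F ij(3) by (auto simp: k_faces_def face_of_imp_convex)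
  then show False
    using F G ij(2) by (simp add: k_faces_def)
qed

section \<open>Flags\<close>

definition flag :: "'a::euclidean_space set \<Rightarrow> nat \<Rightarrow> 'a set \<Rightarrow> (nat \<Rightarrow> 'a set) \<Rightarrow> bool" where
  "flag P k G f \<longleftrightarrow> f k = G \<and> (\<forall>i\<le>k. f i \<in> k_faces (int i) P) \<and> (\<forall>i<k. f i \<subseteq> f (Suc i))"

lemma flag_mono:
  assumes f: "flag P k G f" and ij: "i \<le> j" "j \<le> k"
  shows "f i \<subseteq> f j"
  using ij
proof (induction j rule: dec_induct)
  case (step n)
  then show ?case
    using f unfolding flag_def by (meson Suc_le_eq order_trans less_imp_le)
qed simp

lemma flag_exists:
  assumes P: "polytope P" and G: "G \<in> k_faces (int k) P"
  shows "\<exists>f. flag P k G f"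
  using G
proof (induction k arbitrary: G)
  case 0
  then show ?case
    by (intro exI[of _ "\<lambda>_. G"]) (simp add: flag_def)
next
  case (Suc k)
  have G: "polytope G" "aff_dim G = int (Suc k)" "G face_of P"
    using polytope_k_face[OF P Suc.prems] Suc.prems by (auto simp: k_faces_def)
  obtain F where "F facet_of G"
    using polytope_facet_exists[OF G(1)] G(2) by auto
  then have F: "F face_of G" "F \<in> k_faces (int k) P"
    using G by (auto simp: facet_of_def k_faces_def intro: face_of_trans)
  obtain f where f: "flag P k F f"
    using Suc.IH[OF F(2)] ..
  have "flag P (Suc k) G (f(Suc k := G))"
    using f Suc.prems face_of_imp_subset[OF F(1)] by (auto simp: flag_def less_Suc_eq le_Suc_eq)
  then show ?case by blast
qed

text \<open>The diamond condition, applied between the neighbours of the entry at position \<open>i\<close>, with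
  the empty face below a vertex.\<close>

lemma flag_adjacent:
  fixes P :: "'a::euclidean_space set"
  assumes P: "diamond_condition P" and f: "flag P k G f" and i: "i < k" and k: "k \<le> DIM('a)"
  shows "\<exists>H. H \<noteq> f i \<and> flag P k G (f(i := H))"
proof -
  define F where "F = (if i = 0 then {} else f (i - 1))"
  have F: "F \<in> k_faces (int i - 1) P"
  proof (cases "i = 0")
    case False
    then have "f (i - 1) \<in> k_faces (int (i - 1)) P"
      using f i unfolding flag_def by (metis less_imp_diff_less less_imp_le)
    then show ?thesis
      using False by (simp add: F_def of_nat_diff)
  qed (simp add: F_def k_faces_def)
  have Fi: "F \<subseteq> f i"
    using flag_mono[OF f, of "i - 1" i] i by (simp add: F_def)
  have S: "f (Suc i) \<in> k_faces (int i + 1) P" "f i \<subseteq> f (Suc i)"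
    using f i unfolding flag_def by (metis Suc_leI int_Suc, blast)
  define D where "D = {H \<in> k_faces (int i) P. F \<subseteq> H \<and> H \<subseteq> f (Suc i)}"
  have "card D = 2"
    using P[unfolded diamond_condition_def, rule_format, of "int i + 1" F "f (Suc i)"] F S Fi i k
    by (auto simp: D_def)
  then obtain H where H: "H \<in> D" "H \<noteq> f i"
    by (metis card_2_iff')
  have "flag P k G (f(i := H))"
    using f i H(1) unfolding flag_def D_def F_def
    by (auto split: if_splits)
  then show ?thesis
    using H(2) by blast
qed

section \<open>The centroid of a face is the foot of the perpendicular from the center\<close>

text \<open>The vectors from \<open>q\<close> to the centers of the proper faces in a flag of a \<open>k\<close>-face.\<close>

definition center_flag :: "'a::euclidean_space \<Rightarrow> nat \<Rightarrow> (nat \<Rightarrow> 'a set) \<Rightarrow> nat \<Rightarrow> 'a" where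
  "center_flag q k f i = (if i < k then face_center (f i) - q else 0)"

lemma foot_of_perpendicular:
  fixes z :: "'a::euclidean_space"
  assumes G: "G \<noteq> {}" "aff_dim G = int k"
  obtains L q where "subspace L" "dim L = k" "\<And>x. x \<in> G \<Longrightarrow> x - q \<in> L"
    "\<And>u. u \<in> L \<Longrightarrow> (z - q) \<bullet> u = 0"
proof -
  obtain a where a: "a \<in> G"
    using G by blast
  define D where "D = (\<lambda>x. x - a) ` G"
  obtain y w where yw: "y \<in> span D" "\<And>u. u \<in> span D \<Longrightarrow> orthogonal w u" "z - a = y + w"
    using orthogonal_subspace_decomp_exists[of D "z - a"] by blast
  show thesis
  proof
    show "dim (span D) = k"
      using aff_dim_eq_dim_subtract[of a G] a G(2) by (simp add: D_def hull_inc)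
    show "x - (a + y) \<in> span D" if "x \<in> G" for x
    proof -
      have "x - a \<in> span D"
        using that by (auto simp: D_def intro: span_base)
      then have "(x - a) - y \<in> span D"
        using yw(1) by (rule span_diff)
      then show ?thesis
        by (simp add: algebra_simps)
    qed
    show "(z - (a + y)) \<bullet> u = 0" if "u \<in> span D" for u
    proof -
      have "z - (a + y) = w"
        using yw(3) by (simp add: algebra_simps)
      then show ?thesis
        using yw(2)[OF that] by (simp add: orthogonal_def)
    qed
  qed simp
qed

text \<open>For \<open>k > 0\<close>, the flags of \<open>G\<close> give a system of orthoschemes around the foot \<open>q\<close> of the
  perpendicular from \<open>z\<close>. That \<open>c i - c j\<close> is orthogonal to \<open>c j\<close> for \<open>i \<le> j\<close> is the induction
  hypothesis for the \<open>j\<close>-face in the flag. The squared norm \<open>g i\<close> is by Pythagoras the difference of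
  the squared distances from \<open>z\<close> to the center of an \<open>i\<close>-face and to \<open>q\<close>, so it is the same for all
  flags. Since the vertices then sum to zero around \<open>q\<close>, their centroid is \<open>q\<close>.\<close>

lemma face_center_perpendicular:
  fixes P :: "'a::euclidean_space set"
  assumes P: "polytope P" "diamond_condition P" and z: "is_center P z"
    and G: "G \<in> k_faces (int k) P" and x: "x \<in> G"
  shows "(z - face_center G) \<bullet> (x - face_center G) = 0"
  using G x
proof (induction k arbitrary: G x rule: less_induct)
  case (less k)
  have G: "polytope G" "G \<noteq> {}" "G face_of P" "aff_dim G = int k"
    using less.prems polytope_k_face[OF P(1)] k_face_nonempty by (auto simp: k_faces_def)
  have kDIM: "k \<le> DIM('a)"
    using aff_dim_le_DIM[of G] G(4) by simp
  have equidist: "dist z (face_center F) = dist z (face_center F')"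
    if "F \<in> k_faces (int j) P" "F' \<in> k_faces (int j) P" "j < k" for F F' j
  proof -
    have "int j \<in> {0..int DIM('a)}"
      using that(3) kDIM by simp
    then show ?thesis
      using z that(1,2) unfolding is_center_def by blast
  qed
  show ?case
  proof (cases "k = 0")
    case True
    then obtain v where "G = {v}"
      using G(4) by (auto simp: aff_dim_eq_0)
    then show ?thesis
      using less.prems(2) by (simp add: face_center_singleton)
  next
    case False
    then have k: "0 < k" by simp
    obtain L q where L: "subspace L" "dim L = k" "\<And>x. x \<in> G \<Longrightarrow> x - q \<in> L"
      and perp: "\<And>u. u \<in> L \<Longrightarrow> (z - q) \<bullet> u = 0"
      using foot_of_perpendicular[OF G(2,4)] by blast
    obtain f0 where f0: "flag P k G f0"
      using flag_exists[OF P(1) less.prems(1)] ..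
    \<comment> \<open>By equidistance, any flag serves to define the squared norms.\<close>
    define g where
      "g i = (if i < k then (dist z (face_center (f0 i)))\<^sup>2 - (dist z q)\<^sup>2 else 0)" for i
    define C where "C = center_flag q k ` {f. flag P k G f}"
    have face: "f i \<in> k_faces (int i) P" if "flag P k G f" "i \<le> k" for f i
      using that by (simp add: flag_def)
    have sub: "f i \<subseteq> G" if "flag P k G f" "i \<le> k" for f i
      using flag_mono[OF that(1) that(2)] that(1) by (simp add: flag_def)
    have ctr: "face_center (f i) \<in> f i" if "flag P k G f" "i \<le> k" for f i
      using face[OF that]
      by (intro face_center_mem polytope_k_face[OF P(1)] k_face_nonempty) auto
    have ctrG: "face_center (f i) \<in> G" if "flag P k G f" "i \<le> k" for f i
      using ctr[OF that] sub[OF that] by blast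
    have norm_g: "(face_center F - q) \<bullet> (face_center F - q) = g i"
      if F: "F \<in> k_faces (int i) P" "face_center F \<in> G" and i: "i < k" for F i
    proof -
      have "dist z (face_center F) = dist z (face_center (f0 i))"
        using equidist[OF F(1) face[OF f0] i] i by simp
      then have "g i = (dist z (face_center F))\<^sup>2 - (dist z q)\<^sup>2"
        using i by (simp add: g_def)
      moreover have "(z - q) \<bullet> (face_center F - q) = 0"
        by (intro perp L(3) F(2))
      ultimately show ?thesis
        by (simp add: dist_norm power2_norm_eq_inner inner_diff algebra_simps inner_commute)
    qed
    have gram: "center_flag q k f i \<bullet> center_flag q k f j = g j"
      if f: "flag P k G f" and ij: "i \<le> j" for f i j
    proof (cases "j < k")
      case True
      have "(z - face_center (f j)) \<bullet> (face_center (f i) - face_center (f j)) = 0"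
        using less.IH[OF True face[OF f]] True flag_mono[OF f ij] ctr[OF f, of i] ij by auto
      moreover have "(z - q) \<bullet> (face_center (f i) - q) = 0" "(z - q) \<bullet> (face_center (f j) - q) = 0"
        using ctrG[OF f] ij True by (auto intro!: perp L(3))
      ultimately have "(face_center (f i) - q) \<bullet> (face_center (f j) - q)
          = (face_center (f j) - q) \<bullet> (face_center (f j) - q)"
        by (simp add: inner_diff algebra_simps inner_commute)
      then show ?thesis
        using norm_g[OF face[OF f] ctrG[OF f] True] ij True by (simp add: center_flag_def)
    qed (simp add: center_flag_def g_def)
    have adj: "\<exists>H. H \<noteq> f i \<and> flag P k G (f(i := H)) \<and> face_center H \<noteq> face_center (f i)"
      if f: "flag P k G f" and i: "i < k" for f i
    proof -
      obtain H where H: "H \<noteq> f i" "flag P k G (f(i := H))"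
        using flag_adjacent[OF P(2) f i kDIM] by blast
      have "H \<in> k_faces (int i) P"
        using face[OF H(2), of i] i by simp
      then show ?thesis
        using face_center_neq[OF P(1) _ face[OF f], of H i i] H i by auto
    qed
    interpret orthoscheme_system L k g C
    proof
      fix c i assume "c \<in> C"
      then obtain f where f: "flag P k G f" and c: "c = center_flag q k f"
        by (auto simp: C_def)
      show "c i \<in> L"
        using ctrG[OF f, of i] by (auto simp: c center_flag_def intro: L(3) subspace_0 L(1))
      show "k \<le> i \<Longrightarrow> c i = 0"
        by (simp add: c center_flag_def)
      show "c i \<bullet> c j = g j" if "i \<le> j" for j
        unfolding c by (rule gram[OF f that])
      assume i: "i < k"
      obtain H where H: "flag P k G (f(i := H))" "face_center H \<noteq> face_center (f i)"
        using adj[OF f i] by blast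
      have "center_flag q k (f(i := H)) = c(i := face_center H - q)"
        using i by (auto simp: c center_flag_def)
      then have "c(i := face_center H - q) \<in> C"
        using H(1) unfolding C_def by (metis imageI mem_Collect_eq)
      moreover have "face_center H - q \<noteq> c i"
        using H(2) i by (simp add: c center_flag_def)
      ultimately show "\<exists>x. x \<noteq> c i \<and> c(i := x) \<in> C"
        by blast
    next
      fix i assume i: "i < k"
      let ?c = "center_flag q k f0"
      have "(?c i - ?c (Suc i)) \<bullet> (?c i - ?c (Suc i)) = g i - g (Suc i)"
        using gram[OF f0, of i i] gram[OF f0, of i "Suc i"] gram[OF f0, of "Suc i" "Suc i"]
        by (simp add: inner_diff inner_commute)
      moreover have "?c i \<noteq> ?c (Suc i)"
      proof (cases "Suc i < k")
        case True
        have "f0 i \<noteq> f0 (Suc i)"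
          using face[OF f0, of i] face[OF f0, of "Suc i"] i by (auto simp: k_faces_def)
        then show ?thesis
          using face_center_neq[OF P(1) face[OF f0, of i] face[OF f0, of "Suc i"]] i True
          by (simp add: center_flag_def)
      next
        case False
        \<comment> \<open>If one facet had its center at \<open>q\<close>, all facets would, but different facets have
          different centers.\<close>
        show ?thesis
        proof
          assume "?c i = ?c (Suc i)"
          then have 0: "face_center (f0 i) = q"
            using i False by (simp add: center_flag_def)
          obtain H where H: "flag P k G (f0(i := H))" "face_center H \<noteq> face_center (f0 i)"
            using adj[OF f0 i] by blast
          have "(face_center H - q) \<bullet> (face_center H - q) = g i"
            using norm_g[OF _ _ i, of H] face[OF H(1), of i] ctrG[OF H(1), of i] i by simp
          moreover have "g i = 0"
            using norm_g[OF face[OF f0] ctrG[OF f0] i] i 0 by simp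
          ultimately show False
            using H(2) 0 by simp
        qed
      qed
      ultimately show "g (Suc i) < g i"
        by (metis diff_gt_0_iff_gt inner_gt_zero_iff right_minus_eq)
    next
      let ?D = "(\<lambda>F. face_center F - q) ` {F. F face_of P}"
      have "C \<subseteq> {c. \<forall>i. (i \<in> {..<k} \<longrightarrow> c i \<in> ?D) \<and> (i \<notin> {..<k} \<longrightarrow> c i = 0)}"
      proof
        fix c assume "c \<in> C"
        then obtain f where f: "flag P k G f" and c: "c = center_flag q k f"
          by (auto simp: C_def)
        have "f i face_of P" if "i < k" for i
          using face[OF f, of i] that by (simp add: k_faces_def)
        then show "c \<in> {c. \<forall>i. (i \<in> {..<k} \<longrightarrow> c i \<in> ?D) \<and> (i \<notin> {..<k} \<longrightarrow> c i = 0)}"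
          by (auto simp: c center_flag_def)
      qed
      moreover have "finite ?D"
        using finite_polytope_faces[OF P(1)] by simp
      ultimately show "finite C"
        using finite_set_of_finite_funs[of "{..<k}" ?D] finite_subset by blast
      show "C \<noteq> {}"
        using f0 by (auto simp: C_def)
    qed (use L in auto)
    have vert: "v \<in> vertices G \<longleftrightarrow> {v} \<in> k_faces 0 P \<and> v \<in> G" for v
      using extreme_point_of_face[OF G(3), of v]
      by (auto simp: vertices_def k_faces_def face_of_singleton)
    have "(\<Sum>y\<in>(\<lambda>x. x - q) ` vertices G. y) = 0"
    proof (rule vertices_sum_zero[OF k, of "(\<lambda>x. x - q) ` G"])
      show "(\<lambda>x. x - q) ` G \<subseteq> L"
        using L(3) by blast
      show "(\<lambda>x. x - q) ` vertices G \<subseteq> (\<lambda>x. x - q) ` G"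
        using vertices_subset by blast
      show "y \<bullet> y = g 0" if y: "y \<in> (\<lambda>x. x - q) ` vertices G" for y
      proof -
        obtain v where v: "{v} \<in> k_faces 0 P" "v \<in> G" "y = v - q"
          using y by (auto simp: vert)
        then show ?thesis
          using norm_g[of "{v}" 0] k by (simp add: face_center_singleton)
      qed
    next
      fix c assume "c \<in> C"
      then obtain f where f: "flag P k G f" and c: "c = center_flag q k f"
        by (auto simp: C_def)
      show "c i \<in> (\<lambda>x. x - q) ` G" if "i < k" for i
        using that ctrG[OF f, of i] by (simp add: c center_flag_def)
      obtain v where "f 0 = {v}"
        using face[OF f, of 0] by (auto simp: k_faces_def aff_dim_eq_0)
      then show "c 0 \<in> (\<lambda>x. x - q) ` vertices G"
        using face[OF f, of 0] sub[OF f, of 0] k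
        by (simp add: c center_flag_def face_center_singleton vert)
      define F where "F = f (k - 1)"
      have F: "F face_of P" "aff_dim F < aff_dim G" "F \<subseteq> G"
        using face[OF f, of "k - 1"] sub[OF f, of "k - 1"] k G(4) by (auto simp: F_def k_faces_def)
      then have "F exposed_face_of G"
        using G by (simp add: exposed_face_of_polyhedron polytope_imp_polyhedron face_of_face)
      then obtain a b where ab: "G \<subseteq> {x. a \<bullet> x \<le> b}" "F = G \<inter> {x. a \<bullet> x = b}"
        by (auto simp: exposed_face_of_def)
      have "a \<bullet> c i = b - a \<bullet> q" if "i < k" for i
      proof -
        have "i \<le> k - 1"
          using that by simp
        then have "face_center (f i) \<in> F"
          using ctr[OF f, of i] flag_mono[OF f, of i "k - 1"] that by (auto simp: F_def)
        then show ?thesis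
          using ab that by (simp add: c center_flag_def inner_diff_right)
      qed
      moreover have "\<exists>y\<in>G. a \<bullet> y \<noteq> b"
      proof -
        have "F \<noteq> G"
          using F(2) by auto
        then show ?thesis
          using ab(2) by auto
      qed
      ultimately show "\<exists>a b. (\<forall>y\<in>(\<lambda>x. x - q) ` G. a \<bullet> y \<le> b) \<and> (\<forall>i<k. a \<bullet> c i = b)
          \<and> (\<exists>y\<in>(\<lambda>x. x - q) ` G. a \<bullet> y \<noteq> b)"
        using ab(1) by (intro exI[of _ a] exI[of _ "b - a \<bullet> q"]) (auto simp: inner_diff_right)
    qed
    then have "(\<Sum>v\<in>vertices G. v - q) = 0"
      by (subst (asm) sum.reindex) (auto simp: inj_on_def)
    then have "face_center G = q"
      using sum_vertices_diff(1)[OF G(1,2), of q] sum_vertices_diff(2)[OF G(1,2)] by simp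
    then show ?thesis
      using perp L(3) less.prems(2) by simp
  qed
qed

section \<open>Sums of squared distances\<close>

text \<open>Each chord is the segment of exactly two ordered pairs, and the pairs \<open>(v, v)\<close> contribute
  nothing.\<close>

lemma sum_chords:
  assumes fin: "finite (vertices P)"
  shows "2 * (\<Sum>K\<in>chords P. (diameter K)\<^sup>2) = (\<Sum>v\<in>vertices P. \<Sum>w\<in>vertices P. (dist v w)\<^sup>2)"
proof -
  define V where "V = vertices P"
  define S where "S = {(v, w). v \<in> V \<and> w \<in> V \<and> v \<noteq> w}"
  let ?seg = "\<lambda>(v, w). closed_segment v w"
  have finS: "finite S"
    by (rule finite_subset[of _ "V \<times> V"]) (auto simp: S_def V_def fin)
  have chords: "chords P = ?seg ` S"
    unfolding chords_def S_def V_def by force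
  have fibre: "(\<Sum>(v, w)\<in>{p \<in> S. ?seg p = K}. (dist v w)\<^sup>2) = 2 * (diameter K)\<^sup>2"
    if K: "K \<in> chords P" for K
  proof -
    obtain v w where vw: "(v, w) \<in> S" "K = closed_segment v w"
      using K chords by auto
    have "{p \<in> S. ?seg p = K} = {(v, w), (w, v)}"
      using vw by (auto simp: S_def doubleton_eq_iff simp flip: closed_segment_commute)
    moreover have "v \<noteq> w"
      using vw by (simp add: S_def)
    ultimately show ?thesis
      by (simp add: vw(2) diameter_segment dist_commute)
  qed
  have "2 * (\<Sum>K\<in>chords P. (diameter K)\<^sup>2)
      = (\<Sum>K\<in>?seg ` S. \<Sum>(v, w)\<in>{p \<in> S. ?seg p = K}. (dist v w)\<^sup>2)"
    by (simp add: sum_distrib_left fibre chords)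
  also have "\<dots> = (\<Sum>(v, w)\<in>S. (dist v w)\<^sup>2)"
    by (rule sum.image_gen[OF finS, symmetric])
  also have "\<dots> = (\<Sum>(v, w)\<in>V \<times> V. (dist v w)\<^sup>2)"
    by (rule sum.mono_neutral_left) (auto simp: S_def V_def fin)
  finally show ?thesis
    by (simp add: sum.cartesian_product V_def)
qed

text \<open>Expand \<open>dist v w ^ 2 = 2 - 2 * (v - z) \<bullet> (w - z)\<close>; the inner products sum to the squared norm
  of \<open>\<Sum>v\<in>V. v - z\<close>.\<close>

lemma sum_dist_squared_balanced:
  fixes z :: "'a::real_inner"
  assumes V: "V \<subseteq> sphere z 1" and balanced: "(\<Sum>v\<in>V. v - z) = 0"
  shows "(\<Sum>v\<in>V. \<Sum>w\<in>V. (dist v w)\<^sup>2) = 2 * (real (card V))\<^sup>2"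
proof -
  have unit: "(v - z) \<bullet> (v - z) = 1" if "v \<in> V" for v
  proof -
    have "norm (v - z) = 1"
      using V that by (auto simp: dist_norm norm_minus_commute)
    then show ?thesis
      by (simp add: norm_eq_1)
  qed
  have "(dist v w)\<^sup>2 = 2 - 2 * ((v - z) \<bullet> (w - z))" if "v \<in> V" "w \<in> V" for v w
  proof -
    have "(dist v w)\<^sup>2 = ((v - z) - (w - z)) \<bullet> ((v - z) - (w - z))"
      by (simp add: dist_norm power2_norm_eq_inner)
    also have "\<dots> = 2 - 2 * ((v - z) \<bullet> (w - z))"
      unfolding inner_diff_left[of "v - z" "w - z"] inner_diff_right[of _ "v - z" "w - z"]
      using unit that by (simp add: inner_commute)
    finally show ?thesis .
  qed
  then have "(\<Sum>v\<in>V. \<Sum>w\<in>V. (dist v w)\<^sup>2) = (\<Sum>v\<in>V. \<Sum>w\<in>V. 2 - 2 * ((v - z) \<bullet> (w - z)))"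
    by simp
  also have "\<dots> = (\<Sum>v\<in>V. 2 * real (card V) - 2 * ((v - z) \<bullet> (\<Sum>w\<in>V. w - z)))"
    proof (rule sum.cong)
    show "(\<Sum>w\<in>V. 2 - 2 * ((v - z) \<bullet> (w - z)))
        = 2 * real (card V) - 2 * ((v - z) \<bullet> (\<Sum>w\<in>V. w - z))" for v
      by (subst sum_subtractf) (simp add: inner_sum_right sum_distrib_left)
  qed simp
  also have "\<dots> = 2 * (real (card V))\<^sup>2"
    by (simp add: balanced power2_eq_square)
  finally show ?thesis .
qed

theorem theorem3p4:
  fixes P :: "(real ^ 'n) set" and z :: "real ^ 'n"
  assumes "CARD('n) \<ge> 2"
    and "regular_polytope P"
    and "inscribed_in_sphere P z 1"
  shows "(\<Sum>K\<in>chords P. (diameter K)\<^sup>2) = (real (card (vertices P)))\<^sup>2"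
proof -
  have P: "polytope P" "diamond_condition P" "aff_dim P = int DIM(real ^ 'n)"
    using assms(2) by (auto simp: regular_polytope_def full_polytope_def)
  have z: "is_center P z" "vertices P \<subseteq> sphere z 1"
    using assms(3) by (auto simp: inscribed_in_sphere_def)
  have PP: "P \<in> k_faces (int DIM(real ^ 'n)) P"
    using P by (simp add: k_faces_def face_of_refl polytope_imp_convex del: DIM_cart)
  have ne: "P \<noteq> {}"
    using k_face_nonempty[OF PP] by simp
  define c where "c = face_center P"
  \<comment> \<open>\<open>z - c\<close> is orthogonal to \<open>x - c\<close> for all \<open>x\<close> in \<open>P\<close>, hence to the whole space.\<close>
  have "P \<subseteq> {x. (z - c) \<bullet> x = (z - c) \<bullet> c}"
    using face_center_perpendicular[OF P(1,2) z(1) PP] by (auto simp: c_def inner_diff_right)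
  moreover have "interior P \<noteq> {}"
    using P(1,3) aff_dim_eq_full[of P] rel_interior_eq_empty[of P] ne
    by (metis polytope_imp_convex rel_interior_interior)
  ultimately have "z - c = 0"
    using interior_hyperplane[of "z - c" "(z - c) \<bullet> c"] interior_mono by blast
  then have "z = c"
    by simp
  moreover have "(\<Sum>v\<in>vertices P. v - c) = 0"
    using sum_vertices_diff(1)[OF P(1) ne] by (simp add: c_def)
  ultimately show ?thesis
    using sum_chords[OF finite_vertices[OF P(1)]] sum_dist_squared_balanced[OF z(2)] by simp
qed

end
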